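(* Let $S_j$ be local potentials satisfying (A)–(E), let $\omega\in\mathbb{R}^d$, let $x\in\overline{\mathcal{B}}_\omega$ be a global minimizer, and let $[y^-,y^+]$ be a gap of the Aubry–Mather set $\mathcal{M}(x)$. Let $\Gamma$ be a ghost circle with $\mathcal{M}(x)\subset\Gamma$. If every configuration in $\Gamma\cap[y^-,y^+]$ is stationary, then every configuration in $\Gamma\cap[y^-,y^+]$ is a global minimizer.
   Context: Notation: $\|i\|=\sum_{k=1}^d|i_k|$, $B_j^r=\{k:\|k-j\|\le r\}$, $(\tau_{k,l}x)_i=x_{i+k}+l$. Local potentials $S_j:\mathbb{R}^{\mathbb{Z}^d}\to\mathbb{R}$, $j\in\mathbb{Z}^d$, satisfy: (A) there is $r\in(0,\infty)$ and $C^2$ functions $s_j:\mathbb{R}^{B_j^r}\to\mathbb{R}$ with $S_j(x)=s_j(x|_{B_j^r})$; (B) $S_j(\tau_{k,l}x)=S_{j+k}(x)$; (C) each $S_j$ is bounded below and $S_j(x)\to\infty$ as $|x_k-x_j|\to\infty$ whenever $\|k-j\|=1$; (D) $\partial_{i,k}S_j\le0$ for $i\ne k$, and $\partial_{i,k}S_i<0$ when $\|i-k\|=1$; (E) $|\partial_{i,k}S_j|\le C$ uniformly. Order: $x\le y$ iff $x_i\le y_i$ for all $i$; $x\ll y$ iff $x_i<y_i$ for all $i$; $[a,b]=\{z:a\le z\le b\}$. Birkhoff, rotation vector: $\tau_{k,l}x\ge x$ or $\le x$ for all $(k,l)$; $\lim_nx_{ni}/n=\langle\omega,i\rangle$. $\overline{\mathcal{B}}_\omega$: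 Birkhoff configurations of rotation vector $\omega$ with $\tau_{k,l}x=x$ whenever $\langle\omega,k\rangle+l=0$. Stationary: $\sum_{\|j-i\|\le r}\partial_iS_j(x)=0$ for all $i$. Global minimizer: $W_B(x+y)\ge W_B(x)$ for every finite $B$ and every $y$ supported in $\mathring{B}^{(r)}=\{i\in B:B_i^r\subset B\}$, $W_B=\sum_{j\in B}S_j$. $\widetilde{\mathcal{M}}(x)$ is the pointwise closure of $\{\tau_{k,l}x:(k,l)\in\mathbb{Z}^d\times\mathbb{Z}\}$. The Aubry–Mather set $\mathcal{M}(x)$ is $\widetilde{\mathcal{M}}(x)$ if $\omega\in\mathbb{Q}^d$, and if $\omega\notin\mathbb{Q}^d$ it is $\{y\in\widetilde{\mathcal{M}}(x):y=\lim_n\tau_{k_n,l_n}y\text{ pointwise for some }(k_n,l_n)\text{ with }\langle\omega,k_n\rangle+l_n\ne0\}$. A gap of $\mathcal{M}(x)$ is an order interval $[y^-,y^+]$ with $y^-,y^+\in\mathcal{M}(x)$, $y^-\ll y^+$, containing no element of $\mathcal{M}(x)$ other than $y^\pm$. $\mathbb{X}=\{x:\sum_i2^{-\|i\|}|x_i|<\infty\}$; $(\nabla W(x))_i=\sum_{\|j-i\|\le r}\partial_iS_j(x)$; $\Psi_t$ the complete flow of $\dot x=-\nabla W(x)$ on $\mathbb{X}$. A ghost circle is a set $\Gamma$ that is nonempty, closed and connected (pointwise topology), strictly ordered (for $x,y\in\Gamma$: $x\ll y$, $x=y$ or $y\ll x$), shift-invariant, with $\Psi_t(\Gamma)=\Gamma$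 for all $t$. *)

theory Defs
  imports "HOL-Analysis.Analysis"
begin

type_synonym 'd cfg = "int^'d \<Rightarrow> real"

definition l1norm :: "int^'d::finite \<Rightarrow> int" where
  "l1norm i = (\<Sum>k\<in>UNIV. \<bar>i $ k\<bar>)"

definition ball1 :: "int^'d::finite \<Rightarrow> real \<Rightarrow> (int^'d) set" where
  "ball1 j r = {k. real_of_int (l1norm (k - j)) \<le> r}"

definition tau :: "int^'d::finite \<Rightarrow> int \<Rightarrow> 'd cfg \<Rightarrow> 'd cfg" where
  "tau k l x = (\<lambda>i. x (i + k) + real_of_int l)"

definition ipair :: "real^'d::finite \<Rightarrow> int^'d \<Rightarrow> real" where
  "ipair \<omega> k = (\<Sum>i\<in>UNIV. \<omega> $ i * real_of_int (k $ i))"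

definition pd :: "int^'d::finite \<Rightarrow> ('d cfg \<Rightarrow> real) \<Rightarrow> 'd cfg \<Rightarrow> real" where
  "pd i F x = deriv (\<lambda>t. F (x(i := x i + t))) 0"

definition depends_only :: "(int^'d::finite) set \<Rightarrow> ('d cfg \<Rightarrow> real) \<Rightarrow> bool" where
  "depends_only B F \<longleftrightarrow> (\<forall>x y. (\<forall>k\<in>B. x k = y k) \<longrightarrow> F x = F y)"

text \<open>C^2 in the (finitely many) variables: all partial derivatives up to order two exist
 and are continuous (pointwise = product topology on configurations).\<close>
definition C2_cfg :: "('d::finite cfg \<Rightarrow> real) \<Rightarrow> bool" where
  "C2_cfg F \<longleftrightarrow>
     continuous_on UNIV F \<and>
     (\<forall>i x. ((\<lambda>t. F (x(i := x i + t))) has_real_derivative pd i F x) (at 0)) \<and>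
     (\<forall>i. continuous_on UNIV (pd i F)) \<and>
     (\<forall>i k x. ((\<lambda>t. pd k F (x(i := x i + t))) has_real_derivative pd i (pd k F) x) (at 0)) \<and>
     (\<forall>i k. continuous_on UNIV (pd i (pd k F)))"

definition local_potentials :: "(int^'d::finite \<Rightarrow> 'd cfg \<Rightarrow> real) \<Rightarrow> real \<Rightarrow> bool" where
  "local_potentials S r \<longleftrightarrow>
     \<comment> \<open>(A)\<close>
     0 < r \<and> (\<forall>j. depends_only (ball1 j r) (S j) \<and> C2_cfg (S j)) \<and>
     \<comment> \<open>(B)\<close>
     (\<forall>j k l x. S j (tau k l x) = S (j + k) x) \<and>
     \<comment> \<open>(C)\<close>
     (\<forall>j. bdd_below (range (S j))) \<and>
     (\<forall>j k. l1norm (k - j) = 1 \<longrightarrow>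
        (\<forall>M. \<exists>R. \<forall>x. R < \<bar>x k - x j\<bar> \<longrightarrow> M < S j x)) \<and>
     \<comment> \<open>(D)\<close>
     (\<forall>i k j x. i \<noteq> k \<longrightarrow> pd i (pd k (S j)) x \<le> 0) \<and>
     (\<forall>i k x. l1norm (i - k) = 1 \<longrightarrow> pd i (pd k (S i)) x < 0) \<and>
     \<comment> \<open>(E)\<close>
     (\<exists>C. \<forall>i k j x. \<bar>pd i (pd k (S j)) x\<bar> \<le> C)"

definition sless :: "'d::finite cfg \<Rightarrow> 'd cfg \<Rightarrow> bool" (infix "\<lless>" 50) where
  "x \<lless> y \<longleftrightarrow> (\<forall>i. x i < y i)"

definition birkhoff :: "'d::finite cfg \<Rightarrow> bool" where
  "birkhoff x \<longleftrightarrow> (\<forall>k l. x \<le> tau k l x \<or> tau k l x \<le> x)"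

definition has_rotvec :: "real^'d::finite \<Rightarrow> 'd cfg \<Rightarrow> bool" where
  "has_rotvec \<omega> x \<longleftrightarrow>
     (\<forall>i. (\<lambda>n::nat. x (of_nat n *s i) / real n) \<longlonglongrightarrow> ipair \<omega> i)"

definition Bbar :: "real^'d::finite \<Rightarrow> 'd cfg set" where
  "Bbar \<omega> = {x. birkhoff x \<and> has_rotvec \<omega> x \<and>
              (\<forall>k l. ipair \<omega> k + real_of_int l = 0 \<longrightarrow> tau k l x = x)}"

definition nablaW :: "(int^'d::finite \<Rightarrow> 'd cfg \<Rightarrow> real) \<Rightarrow> real \<Rightarrow> 'd cfg \<Rightarrow> 'd cfg" where
  "nablaW S r x = (\<lambda>i. \<Sum>j\<in>{j. real_of_int (l1norm (j - i)) \<le> r}. pd i (S j) x)"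

definition stationary :: "(int^'d::finite \<Rightarrow> 'd cfg \<Rightarrow> real) \<Rightarrow> real \<Rightarrow> 'd cfg \<Rightarrow> bool" where
  "stationary S r x \<longleftrightarrow> (\<forall>i. nablaW S r x i = 0)"

definition WB :: "(int^'d::finite \<Rightarrow> 'd cfg \<Rightarrow> real) \<Rightarrow> (int^'d) set \<Rightarrow> 'd cfg \<Rightarrow> real" where
  "WB S B x = (\<Sum>j\<in>B. S j x)"

definition interior_r :: "(int^'d::finite) set \<Rightarrow> real \<Rightarrow> (int^'d) set" where
  "interior_r B r = {i\<in>B. ball1 i r \<subseteq> B}"

definition global_minimizer :: "(int^'d::finite \<Rightarrow> 'd cfg \<Rightarrow> real) \<Rightarrow> real \<Rightarrow> 'd cfg \<Rightarrow> bool" where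
  "global_minimizer S r x \<longleftrightarrow>
     (\<forall>B y. finite B \<longrightarrow> (\<forall>i. i \<notin> interior_r B r \<longrightarrow> y i = 0) \<longrightarrow>
        WB S B x \<le> WB S B (\<lambda>i. x i + y i))"

text \<open>Pointwise closure of the orbit (product topology on functions = pointwise topology).\<close>
definition Mtilde :: "'d::finite cfg \<Rightarrow> 'd cfg set" where
  "Mtilde x = closure (range (\<lambda>(k, l). tau k l x))"

definition AM_set :: "real^'d::finite \<Rightarrow> 'd cfg \<Rightarrow> 'd cfg set" where
  "AM_set \<omega> x =
     (if (\<forall>i. \<omega> $ i \<in> \<rat>) then Mtilde x
      else {y \<in> Mtilde x. \<exists>(k::nat \<Rightarrow> int^'d) (l::nat \<Rightarrow> int).
               (\<forall>n. ipair \<omega> (k n) + real_of_int (l n) \<noteq> 0) \<and>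
               (\<forall>i. (\<lambda>n. tau (k n) (l n) y i) \<longlonglongrightarrow> y i)})"

definition is_gap :: "'d::finite cfg set \<Rightarrow> 'd cfg \<Rightarrow> 'd cfg \<Rightarrow> bool" where
  "is_gap M ym yp \<longleftrightarrow> ym \<in> M \<and> yp \<in> M \<and> ym \<lless> yp \<and>
     (\<forall>z\<in>M. ym \<le> z \<and> z \<le> yp \<longrightarrow> z = ym \<or> z = yp)"

definition order_interval :: "'d::finite cfg \<Rightarrow> 'd cfg \<Rightarrow> 'd cfg set" where
  "order_interval a b = {z. a \<le> z \<and> z \<le> b}"

definition Xspace :: "'d::finite cfg set" where
  "Xspace = {x. (\<lambda>i. 2 powr (- real_of_int (l1norm i)) * \<bar>x i\<bar>) summable_on UNIV}"

definition normX :: "'d::finite cfg \<Rightarrow> real" where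
  "normX x = (\<Sum>\<^sub>\<infinity>i. 2 powr (- real_of_int (l1norm i)) * \<bar>x i\<bar>)"

definition is_gradient_flow ::
  "(int^'d::finite \<Rightarrow> 'd cfg \<Rightarrow> real) \<Rightarrow> real \<Rightarrow> (real \<Rightarrow> 'd cfg \<Rightarrow> 'd cfg) \<Rightarrow> bool" where
  "is_gradient_flow S r \<Psi> \<longleftrightarrow>
     (\<forall>x\<in>Xspace. \<Psi> 0 x = x \<and>
        (\<forall>t. \<Psi> t x \<in> Xspace \<and>
             ((\<lambda>h. normX (\<lambda>i. (\<Psi> (t + h) x i - \<Psi> t x i) / h + nablaW S r (\<Psi> t x) i))
                \<longlongrightarrow> 0) (at 0)))"

definition ghost_circle ::
  "(real \<Rightarrow> 'd::finite cfg \<Rightarrow> 'd cfg) \<Rightarrow> 'd cfg set \<Rightarrow> bool" where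
  "ghost_circle \<Psi> \<Gamma> \<longleftrightarrow>
     \<Gamma> \<noteq> {} \<and> closed \<Gamma> \<and> connected \<Gamma> \<and> \<Gamma> \<subseteq> Xspace \<and>
     (\<forall>x\<in>\<Gamma>. \<forall>y\<in>\<Gamma>. x \<lless> y \<or> x = y \<or> y \<lless> x) \<and>
     (\<forall>k l. tau k l ` \<Gamma> \<subseteq> \<Gamma>) \<and>
     (\<forall>t. \<Psi> t ` \<Gamma> = \<Gamma>)"

end

theory Submission
  imports Defs
begin

text \<open>
  Fix \<open>z\<close> in \<open>\<Gamma> \<inter> [y\<^sup>-, y\<^sup>+]\<close> and a finite \<open>B\<close>, and let \<open>w\<close> minimize \<open>W\<^sub>B\<close> among the configurations
  of \<open>[y\<^sup>-, y\<^sup>+]\<close> that agree with \<open>z\<close> off the interior of \<open>B\<close>. If \<open>w \<le> z\<close> fails, connectedness of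
  \<open>\<Gamma>\<close> provides a member \<open>g\<close> of \<open>\<Gamma>\<close> that touches \<open>w\<close> from above, with \<open>z \<lless> g \<le> y\<^sup>+\<close>. At a contact site
  \<open>w\<close> may still be lowered inside the gap, so the gradient of \<open>w\<close> is \<open>\<le> 0\<close> there, while that of \<open>g\<close>
  vanishes; by the twist condition (D) contact then spreads to all neighbours, hence out of the
  finite set, where \<open>w = z \<lless> g\<close>. Symmetrically \<open>w \<ge> z\<close>, so \<open>z\<close> minimizes inside the gap. An arbitrary
  competitor is cut off at \<open>y\<^sup>\<plusminus>\<close>: these are global minimizers, being limits of translates of \<open>x\<close>,
  and \<open>W\<^sub>B\<close> is submodular, so the cut does not increase \<open>W\<^sub>B\<close>.
\<close>

subsection \<open>Configurations\<close>

lemma l1norm_minus_commute: "l1norm (a - b) = l1norm (b - a)"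
  unfolding l1norm_def by (simp add: abs_minus_commute)

text \<open>The ball lies in the cube around \<open>j\<close> of half side \<lceil>r\<rceil>, which
  has finitely many integer points.\<close>

lemma finite_ball1: "finite (ball1 (j :: int^'d::finite) r)"
proof -
  define A where "A = (\<lambda>f. j + vec_lambda f) ` (UNIV \<rightarrow>\<^sub>E {-\<lceil>r\<rceil>..\<lceil>r\<rceil>} :: ('d \<Rightarrow> int) set)"
  have "ball1 j r \<subseteq> A"
  proof
    fix k assume "k \<in> ball1 j r"
    then have le: "l1norm (k - j) \<le> \<lceil>r\<rceil>"
      unfolding ball1_def by (simp add: le_ceiling_iff)
    have "\<bar>(k - j) $ c\<bar> \<le> \<lceil>r\<rceil>" for c
    proof -
      have "\<bar>(k - j) $ c\<bar> \<le> l1norm (k - j)"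
        unfolding l1norm_def by (rule member_le_sum) auto
      with le show ?thesis by linarith
    qed
    then have "(k - j) $ c \<in> {-\<lceil>r\<rceil>..\<lceil>r\<rceil>}" for c
      unfolding atLeastAtMost_iff by (meson abs_le_D1 abs_le_D2 minus_le_iff)
    then have "(($) (k - j)) \<in> UNIV \<rightarrow>\<^sub>E {-\<lceil>r\<rceil>..\<lceil>r\<rceil>}"
      by blast
    moreover have "k = j + vec_lambda (($) (k - j))"
      by (simp add: vec_nth_inverse)
    ultimately show "k \<in> A" unfolding A_def by blast
  qed
  moreover have "finite A"
    unfolding A_def by (intro finite_imageI finite_PiE) auto
  ultimately show ?thesis by (rule finite_subset)
qed

lemma l1norm_axis: "l1norm (axis c 1 :: int^'d::finite) = 1"
proof -
  have "l1norm (axis c 1 :: int^'d) = (\<Sum>k\<in>UNIV. if k = c then 1 else 0)"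
    unfolding l1norm_def axis_def by (rule sum.cong) auto
  then show ?thesis by simp
qed

text \<open>A site of \<open>T\<close> with largest \<open>c\<close>-th coordinate has its neighbour
  in direction \<open>axis c 1\<close> outside \<open>T\<close>. Applied to contact sets, this rules
  out contact confined to a finite window.\<close>

lemma no_finite_neighbour_closed:
  fixes T :: "(int^'d::finite) set"
  assumes "finite T" "T \<noteq> {}" and closed: "\<And>i k. i \<in> T \<Longrightarrow> l1norm (k - i) = 1 \<Longrightarrow> k \<in> T"
  shows False
proof -
  fix c :: 'd
  have "Max ((\<lambda>k. k $ c) ` T) \<in> (\<lambda>k. k $ c) ` T"
    using assms(1,2) by (intro Max_in) auto
  then obtain i where i: "i \<in> T" and "Max ((\<lambda>k. k $ c) ` T) = i $ c"
    by blast
  then have max: "k $ c \<le> i $ c" if "k \<in> T" for k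
    using Max_ge[of "(\<lambda>k. k $ c) ` T" "k $ c"] assms(1) that by simp
  have "i + axis c 1 \<in> T"
    by (rule closed[OF i]) (simp add: l1norm_axis)
  from max[OF this] show False by (simp add: axis_def)
qed

section \<open>Touching and compactness in the pointwise topology\<close>

lemma connected_touching:
  fixes w :: "'a \<Rightarrow> real"
  assumes conn: "connected \<Gamma>" and F: "finite F"
    and a: "a \<in> \<Gamma>" "\<exists>i\<in>F. a i < w i" and b: "b \<in> \<Gamma>" "\<forall>i\<in>F. w i \<le> b i"
  shows "\<exists>g\<in>\<Gamma>. (\<forall>i\<in>F. w i \<le> g i) \<and> (\<exists>i\<in>F. g i = w i)"
proof (rule ccontr)
  assume no: "\<not> ?thesis"
  \<comment> \<open>Without a touching member these sets would separate \<open>b\<close> from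
    \<open>a\<close> within \<Gamma>. Finiteness of \<open>F\<close> makes \<open>U\<close>
    open.\<close>
  define U where "U = (\<Inter>i\<in>F. {g :: 'a \<Rightarrow> real. w i < g i})"
  define V where "V = (\<Union>i\<in>F. {g :: 'a \<Rightarrow> real. g i < w i})"
  have cont: "continuous_on UNIV (\<lambda>g :: 'a \<Rightarrow> real. g i)" for i
    by (rule continuous_on_product_coordinates)
  have "open U"
    unfolding U_def by (intro open_INT F ballI open_Collect_less cont continuous_on_const)
  moreover have "open V"
    unfolding V_def by (intro open_UN ballI open_Collect_less cont continuous_on_const)
  moreover have "\<Gamma> \<subseteq> U \<union> V"
    using no unfolding U_def V_def by (force simp: not_less)
  moreover have "U \<inter> V \<inter> \<Gamma> = {}"
    unfolding U_def V_def by force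
  moreover have "a \<in> V" using a unfolding V_def by auto
  moreover have "b \<in> U"
    using no b unfolding U_def by (force simp: less_le)
  ultimately show False
    using connectedD[OF conn] a(1) b(1) by blast
qed

lemma connected_touching_below:
  fixes w :: "'a \<Rightarrow> real"
  assumes conn: "connected \<Gamma>" and F: "finite F"
    and a: "a \<in> \<Gamma>" "\<exists>i\<in>F. w i < a i" and b: "b \<in> \<Gamma>" "\<forall>i\<in>F. b i \<le> w i"
  shows "\<exists>g\<in>\<Gamma>. (\<forall>i\<in>F. g i \<le> w i) \<and> (\<exists>i\<in>F. g i = w i)"
proof -
  \<comment> \<open>Negation is continuous and reverses the order, which reduces the claim to
    touching from above.\<close>
  let ?n = "\<lambda>(g :: 'a \<Rightarrow> real) i. - g i"
  have "continuous_on \<Gamma> ?n"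
    by (intro continuous_on_coordinatewise_then_product continuous_on_minus)
      (rule continuous_on_subset[OF continuous_on_product_coordinates], simp)
  then have "connected (?n ` \<Gamma>)"
    using conn by (rule connected_continuous_image)
  moreover have "?n a \<in> ?n ` \<Gamma>" "?n b \<in> ?n ` \<Gamma>"
    using a b by simp_all
  moreover have "\<exists>i\<in>F. ?n a i < ?n w i" "\<forall>i\<in>F. ?n w i \<le> ?n b i"
    using a b by simp_all
  ultimately obtain g where "g \<in> \<Gamma>" "\<forall>i\<in>F. ?n w i \<le> ?n g i" "\<exists>i\<in>F. ?n g i = ?n w i"
    using connected_touching[OF _ F, of "?n ` \<Gamma>" "?n a" "?n w" "?n b"] by blast
  then show ?thesis by (intro bexI[of _ g]) auto
qed

lemma compact_box:
  fixes a b :: "'a \<Rightarrow> real"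
  shows "compact {w. \<forall>i. w i \<in> {a i..b i}}"
proof -
  have "compactin (product_topology (\<lambda>i. euclidean) UNIV) (\<Pi>\<^sub>E i\<in>UNIV. {a i..b i})"
    unfolding compactin_PiE by auto
  then show ?thesis
    by (simp add: euclidean_product_topology PiE_def Pi_def)
qed

subsection \<open>Monotonicity in single coordinates\<close>

text \<open>The hypothesis at the base point \<open>x(i := x i + s)\<close> becomes, after a shift
  of \<open>t\<close>, the derivative at \<open>s\<close>. Monotonicity criteria then apply along
  the whole coordinate line.\<close>

lemma has_real_derivative_along_coordinate:
  assumes "\<And>x :: 'a \<Rightarrow> real. ((\<lambda>t. G (x(i := x i + t))) has_real_derivative G' x) (at 0)"
  shows "((\<lambda>t. G (x(i := x i + t))) has_real_derivative G' (x(i := x i + s))) (at s)"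
proof -
  have "((\<lambda>t. G (x(i := x i + (t + s)))) has_real_derivative G' (x(i := x i + s))) (at 0)"
    using assms[of "x(i := x i + s)"] by (simp add: add_ac)
  then show ?thesis
    using DERIV_shift[of "\<lambda>t. G (x(i := x i + t))" _ 0 s] by simp
qed

lemma C2_cfg_DERIV:
  assumes "C2_cfg F"
  shows "((\<lambda>t. F (x(i := x i + t))) has_real_derivative pd i F (x(i := x i + s))) (at s)"
  by (rule has_real_derivative_along_coordinate) (use assms in \<open>unfold C2_cfg_def, blast\<close>)

lemma C2_cfg_DERIV2:
  assumes "C2_cfg F"
  shows "((\<lambda>t. pd k F (x(i := x i + t))) has_real_derivative pd i (pd k F) (x(i := x i + s))) (at s)"
  by (rule has_real_derivative_along_coordinate) (use assms in \<open>unfold C2_cfg_def, blast\<close>)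

lemma pd_antimono_coordinate:
  assumes "C2_cfg F" "\<And>x. pd i (pd k F) x \<le> 0" "0 \<le> t"
  shows "pd k F (x(i := x i + t)) \<le> pd k F x"
  using DERIV_nonpos_imp_nonincreasing[OF assms(3), of "\<lambda>t. pd k F (x(i := x i + t))"]
    C2_cfg_DERIV2[OF assms(1)] assms(2) by fastforce

lemma pd_strict_antimono_coordinate:
  assumes "C2_cfg F" "\<And>x. pd i (pd k F) x < 0" "0 < t"
  shows "pd k F (x(i := x i + t)) < pd k F x"
  using DERIV_neg_imp_decreasing[OF assms(3), of "\<lambda>t. pd k F (x(i := x i + t))"]
    C2_cfg_DERIV2[OF assms(1)] assms(2) by fastforce

text \<open>Passes from \<open>w\<close> to \<open>g\<close> on \<open>D\<close> by raising one
  coordinate at a time.\<close>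

lemma antimono_coordinatewise:
  fixes w g :: "'a \<Rightarrow> real"
  assumes "finite D" "\<And>i x t. i \<in> D \<Longrightarrow> 0 \<le> t \<Longrightarrow> G (x(i := x i + t)) \<le> G x"
    and "\<And>i. i \<in> D \<Longrightarrow> w i \<le> g i"
  shows "G (\<lambda>i. if i \<in> D then g i else w i) \<le> (G w :: real)"
  using assms
proof (induction D rule: finite_induct)
  case empty
  then show ?case by simp
next
  case (insert i D)
  let ?h = "\<lambda>j. if j \<in> D then g j else w j"
  have "(\<lambda>j. if j \<in> insert i D then g j else w j) = ?h(i := ?h i + (g i - w i))"
    using insert.hyps by auto
  then have "G (\<lambda>j. if j \<in> insert i D then g j else w j) = G (?h(i := ?h i + (g i - w i)))"
    by (rule arg_cong)
  also have "\<dots> \<le> G ?h"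
    using insert.prems(2)[of i] by (intro insert.prems(1)) auto
  also have "\<dots> \<le> G w"
    using insert by auto
  finally show ?case .
qed

section \<open>Functions of finitely many coordinates\<close>

lemma depends_only_pd:
  assumes "depends_only B F"
  shows "depends_only B (pd i F)"
  unfolding depends_only_def pd_def
proof (intro allI impI)
  fix x y :: "'a cfg" assume "\<forall>k\<in>B. x k = y k"
  then have "F (x(i := x i + t)) = F (y(i := y i + t))" for t
    using assms unfolding depends_only_def
    by (cases "i \<in> B") (metis fun_upd_apply)+
  then show "deriv (\<lambda>t. F (x(i := x i + t))) 0 = deriv (\<lambda>t. F (y(i := y i + t))) 0"
    by simp
qed

lemma pd_eq_0_outside:
  assumes "depends_only B F" "i \<notin> B"
  shows "pd i F x = 0"
proof -
  have "F (x(i := x i + t)) = F x" for t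
    using assms unfolding depends_only_def by (metis fun_upd_apply)
  then show ?thesis unfolding pd_def by simp
qed

subsection \<open>Submodularity\<close>

locale twist_function =
  fixes F :: "(int^'d::finite \<Rightarrow> real) \<Rightarrow> real" and D
  assumes finD: "finite D" and dep: "depends_only D F" and C2: "C2_cfg F"
    and cross: "\<And>i k x. i \<noteq> k \<Longrightarrow> pd i (pd k F) x \<le> 0"
begin

text \<open>Raising any coordinate other than \<open>i\<close> lowers \<open>pd i F\<close> by
  \<open>cross\<close>. The sign of \<open>pd i (pd i F)\<close> is unknown, so coordinate
  \<open>i\<close> must stay fixed, which \<open>eq\<close> ensures.\<close>

lemma pd_antimono:
  assumes le: "w \<le> g" and eq: "g i = w i"
  shows "pd i F g \<le> pd i F w"
proof -
  have "pd i F (\<lambda>j. if j \<in> D - {i} then g j else w j) \<le> pd i F w"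
  proof (rule antimono_coordinatewise)
    show "pd i F (x(j := x j + t)) \<le> pd i F x" if "j \<in> D - {i}" "0 \<le> t" for j x t
      by (rule pd_antimono_coordinate[OF C2 cross]) (use that in auto)
  qed (use finD le in \<open>auto simp: le_fun_def\<close>)
  moreover have "pd i F (\<lambda>j. if j \<in> D - {i} then g j else w j) = pd i F g"
    using depends_only_pd[OF dep, of i] eq unfolding depends_only_def by auto
  ultimately show ?thesis by simp
qed

text \<open>The passage from \<open>w\<close> to \<open>g\<close> is split: raising coordinate
  \<open>k\<close> alone gives a strict drop, and the remaining coordinates cannot undo it.\<close>

lemma pd_strict_antimono:
  assumes le: "w \<le> g" and eq: "g i = w i" and neg: "\<And>x. pd k (pd i F) x < 0" and k: "w k < g k"
  shows "pd i F g < pd i F w"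
proof -
  let ?w = "w(k := w k + (g k - w k))"
  have "pd i F g \<le> pd i F ?w"
    by (rule pd_antimono) (use le eq k in \<open>auto simp: le_fun_def\<close>)
  also have "\<dots> < pd i F w"
    by (rule pd_strict_antimono_coordinate[OF C2 neg]) (use k in auto)
  finally show ?thesis .
qed

text \<open>Integrated form of \<open>pd_antimono\<close>: the difference of the two sides is
  nonincreasing in \<open>t\<close> and vanishes suitably at 0.\<close>

lemma increment_antimono:
  assumes le: "w \<le> g" and eq: "g i = w i" and t: "0 \<le> t"
  shows "F (g(i := g i + t)) - F g \<le> F (w(i := w i + t)) - F w"
proof -
  let ?f = "\<lambda>s. F (g(i := g i + s)) - F (w(i := w i + s))"
  have "?f t \<le> ?f 0"
  proof (rule DERIV_nonpos_imp_nonincreasing[OF t])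
    fix s
    have "(?f has_real_derivative pd i F (g(i := g i + s)) - pd i F (w(i := w i + s))) (at s)"
      by (intro DERIV_diff C2_cfg_DERIV C2)
    moreover have "pd i F (g(i := g i + s)) \<le> pd i F (w(i := w i + s))"
      by (rule pd_antimono) (use le eq in \<open>auto simp: le_fun_def\<close>)
    ultimately show "\<exists>y. (?f has_real_derivative y) (at s) \<and> y \<le> 0"
      by (meson diff_le_0_iff_le)
  qed
  then show ?thesis by simp
qed

text \<open>The coordinates of \<open>E\<close> are replaced one by one. After each replacement the
  two configurations are still ordered and still agree at the next coordinate.\<close>

lemma increments_antimono:
  assumes "finite E" and le: "w \<le> g" and "\<And>i. i \<in> E \<Longrightarrow> g i = w i" "\<And>i. i \<in> E \<Longrightarrow> g i \<le> x i"
  shows "F (\<lambda>i. if i \<in> E then x i else g i) - F g \<le> F (\<lambda>i. if i \<in> E then x i else w i) - F w"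
  using assms(1,3,4)
proof (induction E rule: finite_induct)
  case empty
  then show ?case by simp
next
  case (insert i E)
  let ?h = "\<lambda>b j. if j \<in> E then x j else b j"
  have upd: "(\<lambda>j. if j \<in> insert i E then x j else b j) = (?h b)(i := ?h b i + (x i - g i))"
    if "b i = g i" for b
    using insert.hyps that by auto
  have "F ((?h g)(i := ?h g i + (x i - g i))) - F (?h g)
      \<le> F ((?h w)(i := ?h w i + (x i - g i))) - F (?h w)"
    by (rule increment_antimono) (use le insert in \<open>auto simp: le_fun_def\<close>)
  moreover have "w i = g i" using insert.prems(1)[of i] by simp
  moreover have "F (?h g) - F g \<le> F (?h w) - F w"
    using insert by auto
  ultimately show ?case
    using upd[of g] upd[of w] by simp
qed

lemma submodular: "F (sup x y) + F (inf x y) \<le> F x + F y"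
proof -
  \<comment> \<open>On \<open>D\<close>, overwriting by \<open>x\<close> on \<open>E\<close> turns
    \<open>y\<close> into \<open>sup x y\<close> and \<open>inf x y\<close> into \<open>x\<close>.
    The starting points \<open>y\<close> and \<open>inf x y\<close> agree on \<open>E\<close>, so
    the increments can be compared.\<close>
  define E where "E = {i \<in> D. y i \<le> x i}"
  have "F (\<lambda>i. if i \<in> E then x i else y i) - F y
      \<le> F (\<lambda>i. if i \<in> E then x i else inf x y i) - F (inf x y)"
    by (rule increments_antimono) (use finD in \<open>auto simp: E_def inf_real_def le_fun_def\<close>)
  moreover have "F (\<lambda>i. if i \<in> E then x i else y i) = F (sup x y)"
    using dep unfolding depends_only_def E_def by (auto simp: sup_real_def max_def)
  moreover have "F (\<lambda>i. if i \<in> E then x i else inf x y i) = F x"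
    using dep unfolding depends_only_def E_def by (auto simp: inf_real_def min_def)
  ultimately show ?thesis by simp
qed

end

lemma local_potentials_twist_function:
  assumes "local_potentials S r"
  shows "twist_function (S j) (ball1 j r)"
  using assms by unfold_locales (auto simp: local_potentials_def finite_ball1)

lemma WB_submodular:
  assumes "local_potentials S r"
  shows "WB S B (sup x y) + WB S B (inf x y) \<le> WB S B x + WB S B y"
  unfolding WB_def sum.distrib[symmetric]
  by (intro sum_mono twist_function.submodular[OF local_potentials_twist_function[OF assms]])

subsection \<open>The gradient\<close>

lemma continuous_on_WB:
  assumes "local_potentials S r"
  shows "continuous_on UNIV (WB S B)"
  unfolding WB_def
  by (intro continuous_on_sum) (use assms in \<open>auto simp: local_potentials_def C2_cfg_def\<close>)

text \<open>At an interior site every potential that depends on coordinate \<open>i\<close> has its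
  index in \<open>B\<close>. All other terms of the sum over \<open>B\<close> have zero
  derivative.\<close>

lemma WB_has_real_derivative:
  assumes S: "local_potentials S r" and B: "finite B" and i: "i \<in> interior_r B r"
  shows "((\<lambda>t. WB S B (x(i := x i + t))) has_real_derivative nablaW S r x i) (at 0)"
proof -
  have "((\<lambda>t. WB S B (x(i := x i + t))) has_real_derivative (\<Sum>j\<in>B. pd i (S j) x)) (at 0)"
    unfolding WB_def
    by (intro DERIV_sum) (use S in \<open>auto simp: local_potentials_def C2_cfg_def\<close>)
  moreover have "(\<Sum>j\<in>B. pd i (S j) x) = nablaW S r x i"
    unfolding nablaW_def
  proof (rule sum.mono_neutral_right[OF B])
    show "{j. real_of_int (l1norm (j - i)) \<le> r} \<subseteq> B"
      using i by (auto simp: interior_r_def ball1_def)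
    show "\<forall>j\<in>B - {j. real_of_int (l1norm (j - i)) \<le> r}. pd i (S j) x = 0"
    proof
      fix j assume "j \<in> B - {j. real_of_int (l1norm (j - i)) \<le> r}"
      then have "i \<notin> ball1 j r"
        by (simp add: ball1_def l1norm_minus_commute)
      then show "pd i (S j) x = 0"
        using S by (intro pd_eq_0_outside) (auto simp: local_potentials_def)
    qed
  qed
  ultimately show ?thesis by simp
qed

text \<open>For \<open>r < 1\<close> the potential at 0 would not see its neighbours, against the
  strict sign in (D). The bound puts each neighbour of \<open>i\<close> among the indices of the sum
  \<open>nablaW S r x i\<close>.\<close>

lemma local_potentials_range_ge_1:
  fixes S :: "int^'d::finite \<Rightarrow> 'd cfg \<Rightarrow> real"
  assumes "local_potentials S r"
  shows "1 \<le> r"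
proof (rule ccontr)
  assume r: "\<not> 1 \<le> r"
  fix c :: 'd
  let ?k = "axis c 1 :: int^'d"
  have "?k \<notin> ball1 0 r"
    using r by (simp add: ball1_def l1norm_axis)
  then have "pd ?k (S 0) = (\<lambda>x. 0)"
    using assms by (intro ext pd_eq_0_outside) (auto simp: local_potentials_def)
  then have "pd 0 (pd ?k (S 0)) (\<lambda>_. 0) = 0"
    by (simp add: pd_def)
  moreover have "pd 0 (pd ?k (S 0)) (\<lambda>_. 0) < 0"
  proof -
    have "l1norm (0 - ?k) = 1"
      using l1norm_axis[of c] l1norm_minus_commute[of 0 ?k] by simp
    then show ?thesis using assms unfolding local_potentials_def by blast
  qed
  ultimately show False by simp
qed

text \<open>A discrete strong comparison principle: if \<open>w k < g k\<close>, the term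
  \<open>j = k\<close> of the gradient at \<open>i\<close> drops strictly from \<open>w\<close> to
  \<open>g\<close> and no other term rises, contrary to \<open>grad\<close>.\<close>

lemma contact_spreads:
  assumes S: "local_potentials S r" and le: "w \<le> g" and eq: "g i = w i"
    and grad: "nablaW S r w i \<le> nablaW S r g i" and k: "l1norm (k - i) = 1"
  shows "g k = w k"
proof (rule ccontr)
  assume "g k \<noteq> w k"
  with le have lt: "w k < g k" by (metis le_funD less_le)
  have fin: "finite {j. real_of_int (l1norm (j - i)) \<le> r}"
    using finite_ball1[of i r] by (simp add: ball1_def)
  have mem: "k \<in> {j. real_of_int (l1norm (j - i)) \<le> r}"
    using k local_potentials_range_ge_1[OF S] by simp
  \<comment> \<open>(D) with the two sites exchanged: strictness comes from the potential centred at
    \<open>k\<close>.\<close>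
  have neg: "pd k (pd i (S k)) x < 0" for x
    using S k unfolding local_potentials_def by blast
  have "nablaW S r g i < nablaW S r w i"
    unfolding nablaW_def
  proof (rule sum_strict_mono_ex1[OF fin])
    show "\<forall>j\<in>{j. real_of_int (l1norm (j - i)) \<le> r}. pd i (S j) g \<le> pd i (S j) w"
      using twist_function.pd_antimono[OF local_potentials_twist_function[OF S] le eq] by blast
    show "\<exists>j\<in>{j. real_of_int (l1norm (j - i)) \<le> r}. pd i (S j) g < pd i (S j) w"
      using twist_function.pd_strict_antimono[OF local_potentials_twist_function[OF S] le eq neg lt]
        mem by blast
  qed
  with grad show False by simp
qed

subsection \<open>Global minimizers\<close>

lemma ball1_translate: "ball1 (i + k) r = (\<lambda>j. j + k) ` ball1 i r"
proof -
  have "j \<in> (\<lambda>j. j + k) ` ball1 i r" if "j \<in> ball1 (i + k) r" for j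
    using that by (intro image_eqI[of _ _ "j - k"]) (auto simp: ball1_def algebra_simps)
  then show ?thesis by (auto simp: ball1_def)
qed

text \<open>By (B), the sum over \<open>B\<close> at a translate is the sum over the shifted window
  at the original configuration, and interiors shift along with windows.\<close>

lemma global_minimizer_tau:
  fixes S :: "int^'d::finite \<Rightarrow> 'd cfg \<Rightarrow> real"
  assumes S: "local_potentials S r" and x: "global_minimizer S r x"
  shows "global_minimizer S r (tau k l x)"
  unfolding global_minimizer_def
proof (intro allI impI)
  fix B :: "(int^'d) set" and y
  assume B: "finite B" and y: "\<forall>i. i \<notin> interior_r B r \<longrightarrow> y i = (0 :: real)"
  let ?B = "(\<lambda>j. j + k) ` B" and ?y = "\<lambda>i. y (i - k)"
  have WB: "WB S B (tau k l u) = WB S ?B u" for u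
    using S by (simp add: WB_def sum.reindex local_potentials_def)
  have "i \<in> interior_r ?B r" if "i - k \<in> interior_r B r" for i
  proof -
    have "i = (i - k) + k" by simp
    moreover have "ball1 i r = (\<lambda>j. j + k) ` ball1 (i - k) r"
      using ball1_translate[of "i - k" k r] by simp
    ultimately show ?thesis using that unfolding interior_r_def by blast
  qed
  then have "\<forall>i. i \<notin> interior_r ?B r \<longrightarrow> ?y i = 0" using y by blast
  then have "WB S ?B x \<le> WB S ?B (\<lambda>i. x i + ?y i)"
    using x[unfolded global_minimizer_def, rule_format, of ?B ?y] B by simp
  moreover have "(\<lambda>i. tau k l x i + y i) = tau k l (\<lambda>i. x i + ?y i)"
    by (simp add: tau_def fun_eq_iff)
  ultimately show "WB S B (tau k l x) \<le> WB S B (\<lambda>i. tau k l x i + y i)"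
    by (simp add: WB)
qed

lemma closed_global_minimizers:
  assumes S: "local_potentials S r"
  shows "closed {x. global_minimizer S r x}"
proof -
  have cont: "continuous_on UNIV (\<lambda>x. WB S B (\<lambda>i. x i + y i))" for B y
  proof (rule continuous_on_compose2[OF continuous_on_WB[OF S]])
    show "continuous_on UNIV (\<lambda>x i. x i + y i)"
      by (intro continuous_on_coordinatewise_then_product continuous_on_add
          continuous_on_product_coordinates continuous_on_const)
  qed simp
  show ?thesis
    unfolding global_minimizer_def
    by (intro closed_Collect_all closed_Collect_imp open_Collect_const closed_Collect_le
        continuous_on_WB[OF S] cont)
qed

lemma AM_set_global_minimizer:
  assumes S: "local_potentials S r" and x: "global_minimizer S r x" and y: "y \<in> AM_set \<omega> x"
  shows "global_minimizer S r y"
proof -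
  have "Mtilde x \<subseteq> {x. global_minimizer S r x}"
    unfolding Mtilde_def
    by (rule closure_minimal)
      (use closed_global_minimizers[OF S] global_minimizer_tau[OF S x] in auto)
  moreover have "y \<in> Mtilde x"
    using y unfolding AM_set_def by (auto split: if_splits)
  ultimately show ?thesis by auto
qed

section \<open>Cutting off at a global minimizer\<close>

lemma global_minimizer_le:
  assumes "global_minimizer S r x" "finite B" "\<And>i. i \<notin> interior_r B r \<Longrightarrow> w i = x i"
  shows "WB S B x \<le> WB S B w"
proof -
  have "WB S B x \<le> WB S B (\<lambda>i. x i + (w i - x i))"
    using assms unfolding global_minimizer_def by (metis diff_self)
  then show ?thesis by simp
qed

text \<open>The part of \<open>w\<close> above \<open>y\<close> is a variation of \<open>y\<close>,
  so \<open>sup w y\<close> costs at least as much as \<open>y\<close>. Submodularity converts this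
  into a gain for \<open>inf w y\<close>.\<close>

lemma WB_inf_le:
  assumes S: "local_potentials S r" and y: "global_minimizer S r y" and B: "finite B"
    and out: "\<And>i. i \<notin> interior_r B r \<Longrightarrow> w i \<le> y i"
  shows "WB S B (inf w y) \<le> WB S B w"
proof -
  have "WB S B y \<le> WB S B (sup w y)"
    by (rule global_minimizer_le[OF y B]) (use out in \<open>auto simp: sup_absorb2\<close>)
  with WB_submodular[OF S, of B w y] show ?thesis by linarith
qed

lemma WB_sup_le:
  assumes S: "local_potentials S r" and y: "global_minimizer S r y" and B: "finite B"
    and out: "\<And>i. i \<notin> interior_r B r \<Longrightarrow> y i \<le> w i"
  shows "WB S B (sup w y) \<le> WB S B w"
proof -
  have "WB S B y \<le> WB S B (inf w y)"
    by (rule global_minimizer_le[OF y B]) (use out in \<open>auto simp: inf_absorb2\<close>)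
  with WB_submodular[OF S, of B w y] show ?thesis by linarith
qed

subsection \<open>Minimizers inside a stationary foliation\<close>

locale stationary_foliation =
  fixes S :: "int^'d::finite \<Rightarrow> 'd cfg \<Rightarrow> real" and r :: real and \<Gamma> :: "'d cfg set"
    and ym yp z :: "'d cfg" and B :: "(int^'d) set"
  assumes S: "local_potentials S r"
    and conn: "connected \<Gamma>"
    and ordered: "\<And>x y. x \<in> \<Gamma> \<Longrightarrow> y \<in> \<Gamma> \<Longrightarrow> x \<lless> y \<or> x = y \<or> y \<lless> x"
    and ends: "ym \<in> \<Gamma>" "yp \<in> \<Gamma>"
    and stat: "\<And>g. g \<in> \<Gamma> \<Longrightarrow> ym \<le> g \<Longrightarrow> g \<le> yp \<Longrightarrow> stationary S r g"
    and z: "z \<in> \<Gamma>" "ym \<le> z" "z \<le> yp"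
    and B: "finite B"
begin

text \<open>Confinement to the gap gives compactness, and it forces the members of \<Gamma> that
  touch a minimizer to lie in the gap, where \<open>stat\<close> applies.\<close>

definition competitors :: "'d cfg set" where
  "competitors = {w. ym \<le> w \<and> w \<le> yp \<and> (\<forall>i. i \<notin> interior_r B r \<longrightarrow> w i = z i)}"

lemma finite_interior: "finite (interior_r B r)"
  using B by (simp add: interior_r_def)

lemma minimizer_exists: "\<exists>w\<in>competitors. \<forall>v\<in>competitors. WB S B w \<le> WB S B v"
proof (rule continuous_attains_inf)
  let ?I = "interior_r B r"
  \<comment> \<open>Off the interior the sides of the box degenerate to the point
    \<open>z i\<close>.\<close>
  have "competitors = {w. \<forall>i. w i \<in> {if i \<in> ?I then ym i else z i..if i \<in> ?I then yp i else z i}}"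
    (is "_ = ?box")
  proof (intro equalityI subsetI)
    fix w assume "w \<in> ?box"
    then have *: "(if i \<in> ?I then ym i else z i) \<le> w i" "w i \<le> (if i \<in> ?I then yp i else z i)" for i
      by auto
    have "ym i \<le> w i \<and> w i \<le> yp i" for i
      using *[of i] z(2,3) by (cases "i \<in> ?I") (auto simp: le_fun_def intro: order_trans)
    moreover have "w i = z i" if "i \<notin> ?I" for i
      using *[of i] that by auto
    ultimately show "w \<in> competitors"
      by (auto simp: competitors_def le_fun_def)
  qed (auto simp: competitors_def le_fun_def)
  then show "compact competitors" by (simp only: compact_box)
  show "competitors \<noteq> {}"
    using z by (auto simp: competitors_def)
  show "continuous_on competitors (WB S B)"
    using continuous_on_WB[OF S] continuous_on_subset by blast
qed

section \<open>Comparison of a minimizer with the foliation\<close>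

context
  fixes w
  assumes w: "w \<in> competitors" and min: "\<And>v. v \<in> competitors \<Longrightarrow> WB S B w \<le> WB S B v"
begin

lemma off: "i \<notin> interior_r B r \<Longrightarrow> w i = z i"
  using w by (simp add: competitors_def)

lemma minimizer_gradient_nonpos:
  assumes i: "i \<in> interior_r B r" and free: "ym i < w i"
  shows "nablaW S r w i \<le> 0"
proof (rule ccontr)
  assume "\<not> ?thesis"
  then have "0 < nablaW S r w i" by simp
  from DERIV_pos_inc_left[OF WB_has_real_derivative[OF S B i] this]
  obtain d where d: "0 < d" and dec: "\<And>h. 0 < h \<Longrightarrow> h < d \<Longrightarrow> WB S B (w(i := w i + (0 - h))) < WB S B w"
    by auto
  \<comment> \<open>Small enough for the derivative to decide, and not so large as to pass below
    \<open>ym i\<close>.\<close>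
  define h where "h = min (d / 2) (w i - ym i)"
  have h: "0 < h" "h < d" "h \<le> w i - ym i"
    using d free by (auto simp: h_def)
  have "w(i := w i + (0 - h)) \<in> competitors"
    using w i h by (auto simp: competitors_def le_fun_def intro: order_trans[of _ "w i"])
  from min[OF this] dec[OF h(1,2)] show False by simp
qed

lemma minimizer_gradient_nonneg:
  assumes i: "i \<in> interior_r B r" and free: "w i < yp i"
  shows "0 \<le> nablaW S r w i"
proof (rule ccontr)
  assume "\<not> ?thesis"
  then have "nablaW S r w i < 0" by simp
  from DERIV_neg_dec_right[OF WB_has_real_derivative[OF S B i] this]
  obtain d where d: "0 < d" and dec: "\<And>h. 0 < h \<Longrightarrow> h < d \<Longrightarrow> WB S B (w(i := w i + (0 + h))) < WB S B w"
    by auto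
  define h where "h = min (d / 2) (yp i - w i)"
  have h: "0 < h" "h < d" "h \<le> yp i - w i"
    using d free by (auto simp: h_def)
  have "w(i := w i + (0 + h)) \<in> competitors"
    using w i h by (auto simp: competitors_def le_fun_def intro: order_trans[of _ "w i"])
  from min[OF this] dec[OF h(1,2)] show False by simp
qed

lemma minimizer_le: "w \<le> z"
proof (rule ccontr)
  assume "\<not> w \<le> z"
  then obtain m where m: "m \<in> interior_r B r" "z m < w m"
    using off by (metis le_funI less_irrefl not_le)
  moreover have "\<forall>i\<in>interior_r B r. w i \<le> yp i"
    using w by (auto simp: competitors_def le_fun_def)
  ultimately obtain g i where g: "g \<in> \<Gamma>" "\<forall>i\<in>interior_r B r. w i \<le> g i"
    and i: "i \<in> interior_r B r" "g i = w i"
    using connected_touching[OF conn finite_interior z(1) _ ends(2)] by blast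
  from m g(2) have "z m < g m" by force
  \<comment> \<open>Strict ordering of \<Gamma> upgrades the inequality at the single site
    \<open>m\<close> to all sites.\<close>
  then have zg: "z \<lless> g"
    using ordered[OF z(1) g(1)] unfolding sless_def by (metis less_asym)
  have wg: "w \<le> g"
  proof (rule le_funI)
    show "w j \<le> g j" for j
      using off[of j] g(2) zg by (cases "j \<in> interior_r B r") (auto simp: sless_def less_imp_le)
  qed
  \<comment> \<open>At the contact site, \<open>g i = w i \<le> yp i\<close>.\<close>
  have "\<not> yp \<lless> g"
    using w i by (auto simp: competitors_def le_fun_def sless_def not_less intro!: exI[of _ i])
  then have "g \<le> yp"
    using ordered[OF g(1) ends(2)] by (auto simp: sless_def le_fun_def less_imp_le)
  moreover have "ym \<le> g"
    using z(2) zg unfolding sless_def le_fun_def by (meson order_trans less_imp_le)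
  ultimately have "stationary S r g" using stat g(1) by blast
  define T where "T = {i \<in> interior_r B r. g i = w i}"
  show False
  proof (rule no_finite_neighbour_closed)
    show "finite T" "T \<noteq> {}"
      using finite_interior i by (auto simp: T_def)
    fix j k assume "j \<in> T" and k: "l1norm (k - j) = 1"
    then have j: "j \<in> interior_r B r" "g j = w j" by (auto simp: T_def)
    \<comment> \<open>Hence \<open>ym j < w j\<close> at a contact site, so the lower obstacle is
      inactive there.\<close>
    have "ym j \<le> z j" "z j < g j"
      using z(2) zg by (auto simp: le_fun_def sless_def)
    then have "nablaW S r w j \<le> nablaW S r g j"
      using minimizer_gradient_nonpos[OF j(1)] j(2) \<open>stationary S r g\<close>
      by (simp add: stationary_def)
    from contact_spreads[OF S wg j(2) this k] have "g k = w k" .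
    \<comment> \<open>Off the interior, \<open>w k = z k < g k\<close> excludes contact.\<close>
    moreover from this have "k \<in> interior_r B r"
      using off[of k] zg unfolding sless_def by (metis less_irrefl)
    ultimately show "k \<in> T" by (simp add: T_def)
  qed
qed

text \<open>Mirror image of \<open>minimizer_le\<close>: \<Gamma> touches from below on the way from
  \<open>z\<close> to \<open>ym\<close>, and \<open>contact_spreads\<close> is used with
  \<open>g\<close> as the lower configuration.\<close>

lemma minimizer_ge: "z \<le> w"
proof (rule ccontr)
  assume "\<not> z \<le> w"
  then obtain m where m: "m \<in> interior_r B r" "w m < z m"
    using off by (metis le_funI less_irrefl not_le)
  moreover have "\<forall>i\<in>interior_r B r. ym i \<le> w i"
    using w by (auto simp: competitors_def le_fun_def)
  ultimately obtain g i where g: "g \<in> \<Gamma>" "\<forall>i\<in>interior_r B r. g i \<le> w i"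
    and i: "i \<in> interior_r B r" "g i = w i"
    using connected_touching_below[OF conn finite_interior z(1) _ ends(1)] by blast
  from m g(2) have "g m < z m" by force
  then have gz: "g \<lless> z"
    using ordered[OF z(1) g(1)] unfolding sless_def by (metis less_asym)
  have gw: "g \<le> w"
  proof (rule le_funI)
    show "g j \<le> w j" for j
      using off[of j] g(2) gz by (cases "j \<in> interior_r B r") (auto simp: sless_def less_imp_le)
  qed
  have "\<not> g \<lless> ym"
    using w i by (auto simp: competitors_def le_fun_def sless_def not_less intro!: exI[of _ i])
  then have "ym \<le> g"
    using ordered[OF g(1) ends(1)] by (auto simp: sless_def le_fun_def less_imp_le)
  moreover have "g \<le> yp"
    using z(3) gz unfolding sless_def le_fun_def by (meson order_trans less_imp_le)
  ultimately have "stationary S r g" using stat g(1) by blast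
  define T where "T = {i \<in> interior_r B r. g i = w i}"
  show False
  proof (rule no_finite_neighbour_closed)
    show "finite T" "T \<noteq> {}"
      using finite_interior i by (auto simp: T_def)
    fix j k assume "j \<in> T" and k: "l1norm (k - j) = 1"
    then have j: "j \<in> interior_r B r" "w j = g j" by (auto simp: T_def)
    have "z j \<le> yp j" "g j < z j"
      using z(3) gz by (auto simp: le_fun_def sless_def)
    then have "nablaW S r g j \<le> nablaW S r w j"
      using minimizer_gradient_nonneg[OF j(1)] j(2) \<open>stationary S r g\<close>
      by (simp add: stationary_def)
    from contact_spreads[OF S gw j(2) this k] have "g k = w k" by simp
    moreover from this have "k \<in> interior_r B r"
      using off[of k] gz unfolding sless_def by (metis less_irrefl)
    ultimately show "k \<in> T" by (simp add: T_def)
  qed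
qed

end

lemma WB_le_competitor:
  assumes "v \<in> competitors"
  shows "WB S B z \<le> WB S B v"
  using minimizer_exists minimizer_le minimizer_ge assms by (metis order_antisym)

end

theorem mainTheorem19:
  fixes S :: "int^'d::finite \<Rightarrow> (int^'d \<Rightarrow> real) \<Rightarrow> real"
    and r :: real and \<omega> :: "real^'d" and x ym yp :: "int^'d \<Rightarrow> real"
    and \<Psi> :: "real \<Rightarrow> (int^'d \<Rightarrow> real) \<Rightarrow> (int^'d \<Rightarrow> real)"
    and \<Gamma> :: "(int^'d \<Rightarrow> real) set"
  assumes "local_potentials S r"
    and "x \<in> Bbar \<omega>"
    and "global_minimizer S r x"
    and "is_gap (AM_set \<omega> x) ym yp"
    and "is_gradient_flow S r \<Psi>"
    and "ghost_circle \<Psi> \<Gamma>"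
    and "AM_set \<omega> x \<subseteq> \<Gamma>"
    and "\<forall>z \<in> \<Gamma> \<inter> order_interval ym yp. stationary S r z"
  shows "\<forall>z \<in> \<Gamma> \<inter> order_interval ym yp. global_minimizer S r z"
proof
  fix z assume zin: "z \<in> \<Gamma> \<inter> order_interval ym yp"
  then have z: "z \<in> \<Gamma>" "ym \<le> z" "z \<le> yp" by (auto simp: order_interval_def)
  have ends: "ym \<in> AM_set \<omega> x" "yp \<in> AM_set \<omega> x" and "ym \<lless> yp"
    using assms(4) by (auto simp: is_gap_def)
  then have le: "ym \<le> yp" by (auto simp: sless_def le_fun_def less_imp_le)
  have gm: "global_minimizer S r ym" "global_minimizer S r yp"
    using AM_set_global_minimizer[OF assms(1,3)] ends by auto
  show "global_minimizer S r z"
    unfolding global_minimizer_def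
  proof (intro allI impI)
    fix B :: "(int^'d) set" and y assume B: "finite B" and y: "\<forall>i. i \<notin> interior_r B r \<longrightarrow> y i = (0 :: real)"
    interpret stationary_foliation S r \<Gamma> ym yp z B
      using assms(1,6-8) ends z B
      by unfold_locales (auto simp: ghost_circle_def order_interval_def)
    let ?v = "\<lambda>i. z i + y i"
    let ?u = "inf ?v yp"
    \<comment> \<open>This is \<open>?v\<close> clipped to the gap. Off the interior
      \<open>?v\<close> equals \<open>z\<close>, which the clipping leaves unchanged.\<close>
    have "sup ?u ym \<in> competitors"
      using z le y by (auto simp: competitors_def le_fun_def inf_absorb1 sup_absorb1)
    then have "WB S B z \<le> WB S B (sup ?u ym)" by (rule WB_le_competitor)
    also have "\<dots> \<le> WB S B ?u"
      by (rule WB_sup_le[OF assms(1) gm(1) B]) (use z le y in \<open>auto simp: le_fun_def\<close>)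
    also have "\<dots> \<le> WB S B ?v"
      by (rule WB_inf_le[OF assms(1) gm(2) B]) (use z y in \<open>auto simp: le_fun_def\<close>)
    finally show "WB S B z \<le> WB S B ?v" .
  qed
qed

end
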